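(* Let $\mathcal{M}$ be a family of sets (with copies $\mathcal{M}^s,\mathcal{M}^t$ as in the context), and let $(p,\leq)$ be as in the context. Then the structure $\mathit{SplPre}$ of split preorders of $\mathcal{M}$, with identity arrows $\mathbf{1}_X$ and composition $\ast$, is a category; that is, $R\ast\mathbf{1}_X=\mathbf{1}_Y\ast R=R$ for every split preorder $R:X\to Y$, and $\ast$ is associative. Moreover, the maps $F_p$ on objects and on arrows constitute a faithful functor from $\mathit{SplPre}$ to $\mathit{Rel}$, and $F_p$ is one-one on objects and one-one on arrows, so that $\mathit{Rel}$ has as a subcategory an isomorphic copy of $\mathit{SplPre}$.
   Context: Split preorders. Let $\mathcal{M}$ be a family of sets. For $i\in\{s,t\}$ let $\mathcal{M}^i$ be a family of sets in one-to-one correspondence with $\mathcal{M}$; $X^i$ denotes the element of $\mathcal{M}^i$ corresponding to $X\in\mathcal{M}$. For every $X\in\mathcal{M}$ there is a given bijection $i_X:X\to X^i$ (so there are bijections $s_X:X\to X^s$ and $t_X:X\to X^t$). For every $U\in\mathcal{M}$, $V\in\mathcal{M}^s$, $W\in\mathcal{M}^t$, the sets $U,V,W$ are mutually disjoint. For $X,Y\in\mathcal{M}$, a split relation of $\mathcal{M}$ is a triple $\langle R,X,Y\rangle$ with $R\subseteq (X^s\cup Y^t)^2$; it is a split preorder iff $R$ is reflexive (on $X^s\cup Y^t$) and transitive. One writes $R:X\to Y$. The structure $\mathit{SplPre}$. Its objects are the members of $\mathcal{M}$; its arrows are the split preorders $R:X\to Y$ of $\mathcal{M}$, with source $X$ and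 target $Y$. The identity arrow $\mathbf{1}_X:X\to X$ is the split preorder such that for all $i,j\in\{s,t\}$, $u\in X^i$, $v\in X^j$: $(u,v)\in\mathbf{1}_X$ iff $i_X^{-1}(u)=j_X^{-1}(v)$. Composition. For $X,Y\in\mathcal{M}$ let $\varphi^s:X\cup Y^t\to X^s\cup Y^t$ be given by $\varphi^s(x)=s_X(x)$ if $x\in X$ and $\varphi^s(x)=x$ if $x\in Y^t$; let $\varphi^t:X^s\cup Y\to X^s\cup Y^t$ be given by $\varphi^t(x)=x$ if $x\in X^s$ and $\varphi^t(x)=t_Y(x)$ if $x\in Y$. For a split relation $R:X\to Y$ let $R^{-s}\subseteq (X\cup Y^t)^2$ and $R^{-t}\subseteq(X^s\cup Y)^2$ be defined by $(x,y)\in R^{-i}$ iff $(\varphi^i(x),\varphi^i(y))\in R$, for $i\in\{s,t\}$. With $\mathrm{Tr}$ denoting transitive closure, for split preorders $R:X\to Y$ and $P:Y\to Z$ define $$P\ast R=\mathrm{Tr}(R^{-t}\cup P^{-s})\cap(X^s\cup Z^t)^2,$$ which is a split preorder $X\to Z$. The category $\mathit{Rel}$. Its objects are sets in a certain universe and its arrows $a\to b$ are binary relations $R\subseteq a\times b$ between these sets. The identity on $a$ is the identity relation $I_a\subseteq a\times a$. For $R_1\subseteq a\times b$ and $R_2\subseteq b\times c$, $R_2\circ R_1=\{(x,y)\in a\times c\mid (\exists z\in b)(xR_1z \text{ and } zR_2y)\}$. The maps $F_p$. Let $p$ be a set with $2=\{0,1\}\subseteq p$, and let $\leq$ be a linear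 order on $p$, restricting to the usual order on $2$, such that every nonempty subset of $p$ has a greatest element and $0$ is the least element of $p$. On objects, $F_p(X)=p^X$, the set of all functions from $X$ to $p$ (the universe of $\mathit{Rel}$ is assumed to contain $p^X$ for all $X\in\mathcal{M}$). For $f_1:X\to p$ and $f_2:Y\to p$ let $[f_1,f_2]:X^s\cup Y^t\to p$ be given by $[f_1,f_2](u)=f_1(s_X^{-1}(u))$ if $u\in X^s$ and $[f_1,f_2](u)=f_2(t_Y^{-1}(u))$ if $u\in Y^t$. For an arrow $R:X\to Y$ of $\mathit{SplPre}$, $F_p(R)\subseteq p^X\times p^Y$ is defined by: $(f_1,f_2)\in F_p(R)$ iff for all $u,v\in X^s\cup Y^t$, $uRv$ implies $[f_1,f_2](u)\leq[f_1,f_2](v)$. *)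

theory Defs
  imports "HOL-Library.FuncSet"
begin

section \<open>Categories with explicit object and arrow sets\<close>

record ('o, 'm) cat =
  Obj :: "'o set"
  Arr :: "'m set"
  Src :: "'m \<Rightarrow> 'o"
  Tgt :: "'m \<Rightarrow> 'o"
  Ident :: "'o \<Rightarrow> 'm"
  Comp :: "'m \<Rightarrow> 'm \<Rightarrow> 'm"  \<comment> \<open>\<open>Comp C g f\<close> is "g after f", meaningful when \<open>Src C g = Tgt C f\<close>\<close>

locale category =
  fixes C :: "('o, 'm) cat"
  assumes Src_in: "f \<in> Arr C \<Longrightarrow> Src C f \<in> Obj C"
    and Tgt_in: "f \<in> Arr C \<Longrightarrow> Tgt C f \<in> Obj C"
    and Ident_in: "a \<in> Obj C \<Longrightarrow> Ident C a \<in> Arr C"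
    and Src_Ident: "a \<in> Obj C \<Longrightarrow> Src C (Ident C a) = a"
    and Tgt_Ident: "a \<in> Obj C \<Longrightarrow> Tgt C (Ident C a) = a"
    and Comp_in: "\<lbrakk>f \<in> Arr C; g \<in> Arr C; Src C g = Tgt C f\<rbrakk> \<Longrightarrow> Comp C g f \<in> Arr C"
    and Src_Comp: "\<lbrakk>f \<in> Arr C; g \<in> Arr C; Src C g = Tgt C f\<rbrakk> \<Longrightarrow> Src C (Comp C g f) = Src C f"
    and Tgt_Comp: "\<lbrakk>f \<in> Arr C; g \<in> Arr C; Src C g = Tgt C f\<rbrakk> \<Longrightarrow> Tgt C (Comp C g f) = Tgt C g"
    and Comp_Ident_right: "f \<in> Arr C \<Longrightarrow> Comp C f (Ident C (Src C f)) = f"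
    and Comp_Ident_left: "f \<in> Arr C \<Longrightarrow> Comp C (Ident C (Tgt C f)) f = f"
    and Comp_assoc: "\<lbrakk>f \<in> Arr C; g \<in> Arr C; h \<in> Arr C; Src C g = Tgt C f; Src C h = Tgt C g\<rbrakk>
      \<Longrightarrow> Comp C h (Comp C g f) = Comp C (Comp C h g) f"

locale cat_functor = C: category C + D: category D
  for C :: "('o, 'm) cat" and D :: "('q, 'n) cat" +
  fixes Fo :: "'o \<Rightarrow> 'q" and Fa :: "'m \<Rightarrow> 'n"
  assumes Fo_in: "a \<in> Obj C \<Longrightarrow> Fo a \<in> Obj D"
    and Fa_in: "f \<in> Arr C \<Longrightarrow> Fa f \<in> Arr D"
    and Src_Fa: "f \<in> Arr C \<Longrightarrow> Src D (Fa f) = Fo (Src C f)"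
    and Tgt_Fa: "f \<in> Arr C \<Longrightarrow> Tgt D (Fa f) = Fo (Tgt C f)"
    and Fa_Ident: "a \<in> Obj C \<Longrightarrow> Fa (Ident C a) = Ident D (Fo a)"
    and Fa_Comp: "\<lbrakk>f \<in> Arr C; g \<in> Arr C; Src C g = Tgt C f\<rbrakk>
      \<Longrightarrow> Fa (Comp C g f) = Comp D (Fa g) (Fa f)"

locale faithful_functor = cat_functor +
  assumes faithful: "\<lbrakk>f \<in> Arr C; g \<in> Arr C; Src C f = Src C g; Tgt C f = Tgt C g; Fa f = Fa g\<rbrakk>
    \<Longrightarrow> f = g"

locale cat_isomorphism = cat_functor +
  assumes bij_Fo: "bij_betw Fo (Obj C) (Obj D)"
    and bij_Fa: "bij_betw Fa (Arr C) (Arr D)"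

locale subcategory = D: category D + C: category C
  for D C :: "('o, 'm) cat" +
  assumes Obj_sub: "Obj D \<subseteq> Obj C"
    and Arr_sub: "Arr D \<subseteq> Arr C"
    and Src_sub: "f \<in> Arr D \<Longrightarrow> Src D f = Src C f"
    and Tgt_sub: "f \<in> Arr D \<Longrightarrow> Tgt D f = Tgt C f"
    and Ident_sub: "a \<in> Obj D \<Longrightarrow> Ident D a = Ident C a"
    and Comp_sub: "\<lbrakk>f \<in> Arr D; g \<in> Arr D; Src D g = Tgt D f\<rbrakk> \<Longrightarrow> Comp D g f = Comp C g f"


section \<open>The category of split preorders\<close>

datatype side = Side_s | Side_t

text \<open>
  For \<open>X \<in> M\<close>, the set \<open>cp i X\<close> is the copy written X to the i, the family of copies is
  \<open>cp i ` M\<close>, and \<open>emb i X\<close> is the given bijection from X to that copy.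
  Members of M may overlap, and so may copies of the same side.
\<close>

locale split_family =
  fixes M :: "'a set set"
    and cp :: "side \<Rightarrow> 'a set \<Rightarrow> 'a set"
    and emb :: "side \<Rightarrow> 'a set \<Rightarrow> 'a \<Rightarrow> 'a"
  assumes cp_inj: "inj_on (cp i) M"
    and emb_bij: "X \<in> M \<Longrightarrow> bij_betw (emb i X) X (cp i X)"
    and disjoint: "\<lbrakk>U \<in> M; V \<in> cp Side_s ` M; W \<in> cp Side_t ` M\<rbrakk>
      \<Longrightarrow> U \<inter> V = {} \<and> U \<inter> W = {} \<and> V \<inter> W = {}"

type_synonym 'a split_rel = "('a \<times> 'a) set \<times> 'a set \<times> 'a set"

definition split_field :: "(side \<Rightarrow> 'a set \<Rightarrow> 'a set) \<Rightarrow> 'a set \<Rightarrow> 'a set \<Rightarrow> 'a set" where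
  "split_field cp X Y = cp Side_s X \<union> cp Side_t Y"

definition split_relation :: "'a set set \<Rightarrow> (side \<Rightarrow> 'a set \<Rightarrow> 'a set) \<Rightarrow> 'a split_rel \<Rightarrow> bool" where
  "split_relation M cp = (\<lambda>(R, X, Y). X \<in> M \<and> Y \<in> M \<and> R \<subseteq> split_field cp X Y \<times> split_field cp X Y)"

definition split_preorder :: "'a set set \<Rightarrow> (side \<Rightarrow> 'a set \<Rightarrow> 'a set) \<Rightarrow> 'a split_rel \<Rightarrow> bool" where
  "split_preorder M cp = (\<lambda>(R, X, Y). split_relation M cp (R, X, Y) \<and>
     refl_on (split_field cp X Y) R \<and> trans R)"

definition split_id ::
  "(side \<Rightarrow> 'a set \<Rightarrow> 'a set) \<Rightarrow> (side \<Rightarrow> 'a set \<Rightarrow> 'a \<Rightarrow> 'a) \<Rightarrow> 'a set \<Rightarrow> 'a split_rel" where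
  "split_id cp emb X =
    ({(u, v). \<exists>i j. u \<in> cp i X \<and> v \<in> cp j X \<and>
        inv_into X (emb i X) u = inv_into X (emb j X) v}, X, X)"

definition phi_s :: "(side \<Rightarrow> 'a set \<Rightarrow> 'a \<Rightarrow> 'a) \<Rightarrow> 'a set \<Rightarrow> 'a \<Rightarrow> 'a" where
  "phi_s emb X x = (if x \<in> X then emb Side_s X x else x)"

definition phi_t :: "(side \<Rightarrow> 'a set \<Rightarrow> 'a \<Rightarrow> 'a) \<Rightarrow> 'a set \<Rightarrow> 'a \<Rightarrow> 'a" where
  "phi_t emb Y x = (if x \<in> Y then emb Side_t Y x else x)"

definition unsplit_s ::
  "(side \<Rightarrow> 'a set \<Rightarrow> 'a set) \<Rightarrow> (side \<Rightarrow> 'a set \<Rightarrow> 'a \<Rightarrow> 'a) \<Rightarrow> 'a split_rel \<Rightarrow> ('a \<times> 'a) set" where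
  "unsplit_s cp emb = (\<lambda>(R, X, Y).
     {(x, y). x \<in> X \<union> cp Side_t Y \<and> y \<in> X \<union> cp Side_t Y \<and> (phi_s emb X x, phi_s emb X y) \<in> R})"

definition unsplit_t ::
  "(side \<Rightarrow> 'a set \<Rightarrow> 'a set) \<Rightarrow> (side \<Rightarrow> 'a set \<Rightarrow> 'a \<Rightarrow> 'a) \<Rightarrow> 'a split_rel \<Rightarrow> ('a \<times> 'a) set" where
  "unsplit_t cp emb = (\<lambda>(R, X, Y).
     {(x, y). x \<in> cp Side_s X \<union> Y \<and> y \<in> cp Side_s X \<union> Y \<and> (phi_t emb Y x, phi_t emb Y y) \<in> R})"

definition split_comp ::
  "(side \<Rightarrow> 'a set \<Rightarrow> 'a set) \<Rightarrow> (side \<Rightarrow> 'a set \<Rightarrow> 'a \<Rightarrow> 'a) \<Rightarrow>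
   'a split_rel \<Rightarrow> 'a split_rel \<Rightarrow> 'a split_rel" where
  "split_comp cp emb = (\<lambda>(P, Y', Z) (R, X, Y).
     ((unsplit_t cp emb (R, X, Y) \<union> unsplit_s cp emb (P, Y', Z))\<^sup>+
        \<inter> (split_field cp X Z \<times> split_field cp X Z), X, Z))"

definition SplPre ::
  "'a set set \<Rightarrow> (side \<Rightarrow> 'a set \<Rightarrow> 'a set) \<Rightarrow> (side \<Rightarrow> 'a set \<Rightarrow> 'a \<Rightarrow> 'a) \<Rightarrow>
   ('a set, 'a split_rel) cat" where
  "SplPre M cp emb =
    \<lparr> Obj = M,
      Arr = {R. split_preorder M cp R},
      Src = (\<lambda>(R, X, Y). X),
      Tgt = (\<lambda>(R, X, Y). Y),
      Ident = split_id cp emb,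
      Comp = split_comp cp emb \<rparr>"


section \<open>The category of relations over a universe of sets\<close>

definition RelCat :: "'b set set \<Rightarrow> ('b set, ('b \<times> 'b) set \<times> 'b set \<times> 'b set) cat" where
  "RelCat \<U> =
    \<lparr> Obj = \<U>,
      Arr = {(R, a, b). a \<in> \<U> \<and> b \<in> \<U> \<and> R \<subseteq> a \<times> b},
      Src = (\<lambda>(R, a, b). a),
      Tgt = (\<lambda>(R, a, b). b),
      Ident = (\<lambda>a. (Id_on a, a, a)),
      Comp = (\<lambda>(R2, b', c) (R1, a, b). (R1 O R2, a, c)) \<rparr>"


section \<open>The maps $F_p$\<close>

locale value_order =
  fixes p :: "'p set" and le :: "'p rel" and zero one :: 'p
  assumes zero_in: "zero \<in> p"
    and one_in: "one \<in> p"
    and linear: "linear_order_on p le"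
    and zero_neq_one: "zero \<noteq> one"
    and zero_le_one: "(zero, one) \<in> le"
    and greatest: "\<lbrakk>A \<subseteq> p; A \<noteq> {}\<rbrakk> \<Longrightarrow> \<exists>m\<in>A. \<forall>x\<in>A. (x, m) \<in> le"
    and zero_least: "x \<in> p \<Longrightarrow> (zero, x) \<in> le"

definition Fp_obj :: "'p set \<Rightarrow> 'a set \<Rightarrow> ('a \<Rightarrow> 'p) set" where
  "Fp_obj p X = (X \<rightarrow>\<^sub>E p)"

definition copair ::
  "(side \<Rightarrow> 'a set \<Rightarrow> 'a set) \<Rightarrow> (side \<Rightarrow> 'a set \<Rightarrow> 'a \<Rightarrow> 'a) \<Rightarrow> 'a set \<Rightarrow> 'a set \<Rightarrow>
   ('a \<Rightarrow> 'p) \<Rightarrow> ('a \<Rightarrow> 'p) \<Rightarrow> 'a \<Rightarrow> 'p" where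
  "copair cp emb X Y f1 f2 u =
    (if u \<in> cp Side_s X then f1 (inv_into X (emb Side_s X) u)
     else f2 (inv_into Y (emb Side_t Y) u))"

definition Fp_arr ::
  "(side \<Rightarrow> 'a set \<Rightarrow> 'a set) \<Rightarrow> (side \<Rightarrow> 'a set \<Rightarrow> 'a \<Rightarrow> 'a) \<Rightarrow> 'p set \<Rightarrow> 'p rel \<Rightarrow>
   'a split_rel \<Rightarrow> (('a \<Rightarrow> 'p) \<times> ('a \<Rightarrow> 'p)) set \<times> ('a \<Rightarrow> 'p) set \<times> ('a \<Rightarrow> 'p) set" where
  "Fp_arr cp emb p le = (\<lambda>(R, X, Y).
    ({(f1, f2). f1 \<in> Fp_obj p X \<and> f2 \<in> Fp_obj p Y \<and>
        (\<forall>u \<in> split_field cp X Y. \<forall>v \<in> split_field cp X Y.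
           (u, v) \<in> R \<longrightarrow> (copair cp emb X Y f1 f2 u, copair cp emb X Y f1 f2 v) \<in> le)},
     Fp_obj p X, Fp_obj p Y))"

end

theory Submission
  imports Defs
begin

text \<open>
  The category laws of split preorders are awkward to verify directly, because a composite is the
  transitive closure of a union of two relations. They follow from those of relations
  once the maps \<open>F_p\<close> are known to preserve identities and composition and to be
  one-one on arrows: an equation between composites of split preorders holds because its image
  does (\<open>category_reflect\<close>). So everything rests on three properties of \<open>F_p\<close>.

  One-one on arrows (\<open>Fp_arr_subset_imp\<close>): if \<open>(u, v) \<notin> R\<close>, the characteristic function of the cone
  of all \<open>w\<close> with \<open>(u, w) \<in> R\<close>, with values 0 and 1, preserves the preorder \<open>R\<close> but does not send
  \<open>u\<close> below \<open>v\<close>. Hence \<open>R\<close> can be recovered from its order-preserving valuations.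

  Identities (\<open>Fp_arr_id\<close>): a valuation of \<open>X\<^sup>s \<union> X\<^sup>t\<close> that preserves the identity arrow gives
  the two copies of a point values that are below each other, hence equal.

  Composition (\<open>Fp_arr_comp\<close>): put \<open>T = Tr(R\<^bsup>-t\<^esup> \<union> P\<^bsup>-s\<^esup>)\<close> on \<open>X\<^sup>s \<union> Y \<union> Z\<^sup>t\<close>.
  A pair \<open>(f1, f3)\<close> belongs to the composite of the two relations iff some \<open>f2\<close> on the middle set
  \<open>Y\<close> makes the valuation glued from \<open>f1\<close>, \<open>f2\<close>, \<open>f3\<close> preserve \<open>T\<close>; it
  belongs to the image of the composite iff the valuation glued from \<open>f1\<close> and \<open>f3\<close> preserves the
  restriction of \<open>T\<close> to \<open>X\<^sup>s \<union> Z\<^sup>t\<close>. The two agree because a valuation that preserves the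
  restriction of a transitive relation to a subset extends to the whole set (\<open>extend_preserving\<close>);
  this is where the greatest elements and the least value 0 are used.
\<close>

section \<open>Reflecting and transporting category structure\<close>

text \<open>
  Here \<open>C\<close> has the typing of a category, but its unit and associativity laws are still to be shown.
  Both sides of each law are parallel arrows with the same image, so injectivity of the map on
  arrows identifies them.
\<close>

lemma category_reflect:
  assumes D: "category D"
    and Src: "\<And>f. f \<in> Arr C \<Longrightarrow> Src C f \<in> Obj C"
    and Tgt: "\<And>f. f \<in> Arr C \<Longrightarrow> Tgt C f \<in> Obj C"
    and Id: "\<And>a. a \<in> Obj C \<Longrightarrow> Ident C a \<in> Arr C \<and> Src C (Ident C a) = a \<and> Tgt C (Ident C a) = a"
    and Cmp: "\<And>f g. \<lbrakk>f \<in> Arr C; g \<in> Arr C; Src C g = Tgt C f\<rbrakk> \<Longrightarrow>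
      Comp C g f \<in> Arr C \<and> Src C (Comp C g f) = Src C f \<and> Tgt C (Comp C g f) = Tgt C g"
    and Fa: "\<And>f. f \<in> Arr C \<Longrightarrow>
      Fa f \<in> Arr D \<and> Src D (Fa f) = Fo (Src C f) \<and> Tgt D (Fa f) = Fo (Tgt C f)"
    and FId: "\<And>a. a \<in> Obj C \<Longrightarrow> Fa (Ident C a) = Ident D (Fo a)"
    and FCmp: "\<And>f g. \<lbrakk>f \<in> Arr C; g \<in> Arr C; Src C g = Tgt C f\<rbrakk> \<Longrightarrow>
      Fa (Comp C g f) = Comp D (Fa g) (Fa f)"
    and inj: "inj_on Fa (Arr C)"
  shows "category C"
proof -
  interpret D: category D by (rule D)
  show ?thesis
  proof
    fix f assume f: "f \<in> Arr C"
    show "Comp C f (Ident C (Src C f)) = f"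
      by (rule inj_onD[OF inj])
        (use f Src Id Cmp Fa FId FCmp D.Comp_Ident_right[of "Fa f"] in simp_all)
    show "Comp C (Ident C (Tgt C f)) f = f"
      by (rule inj_onD[OF inj])
        (use f Tgt Id Cmp Fa FId FCmp D.Comp_Ident_left[of "Fa f"] in simp_all)
  next
    fix f g h
    assume "f \<in> Arr C" "g \<in> Arr C" "h \<in> Arr C" "Src C g = Tgt C f" "Src C h = Tgt C g"
    then show "Comp C h (Comp C g f) = Comp C (Comp C h g) f"
      by (intro inj_onD[OF inj]) (simp_all add: Cmp Fa FCmp D.Comp_assoc)
  qed (simp_all add: Src Tgt Id Cmp)
qed

text \<open>
  Without injectivity on objects the image need not be closed under composition: two arrows of
  the source could have composable images without being composable themselves.
\<close>

lemma (in cat_functor) image_subcategory: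
  assumes injo: "inj_on Fo (Obj C)" and inja: "inj_on Fa (Arr C)"
  shows "\<exists>E. subcategory E D \<and> cat_isomorphism C E Fo Fa"
proof -
  define E where "E = D\<lparr>Obj := Fo ` Obj C, Arr := Fa ` Arr C\<rparr>"
  have composable: "Src C g = Tgt C f"
    if "f \<in> Arr C" "g \<in> Arr C" "Src D (Fa g) = Tgt D (Fa f)" for f g
    using that by (intro inj_onD[OF injo]) (simp_all add: Src_Fa Tgt_Fa C.Src_in C.Tgt_in)
  have Comp_in_image: "Comp D (Fa g) (Fa f) \<in> Fa ` Arr C"
    if "f \<in> Arr C" "g \<in> Arr C" "Src D (Fa g) = Tgt D (Fa f)" for f g
    using that composable[OF that] by (metis C.Comp_in Fa_Comp imageI)
  have Ident_in_image: "Ident D (Fo a) \<in> Fa ` Arr C" if "a \<in> Obj C" for a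
    using that by (metis C.Ident_in Fa_Ident imageI)
  have unit: "Comp D (Fa f) (Ident D (Fo (Src C f))) = Fa f"
    "Comp D (Ident D (Fo (Tgt C f))) (Fa f) = Fa f" if "f \<in> Arr C" for f
    using that D.Comp_Ident_right[of "Fa f"] D.Comp_Ident_left[of "Fa f"]
    by (simp_all add: Fa_in Src_Fa Tgt_Fa)
  have E: "category E"
    unfolding E_def
    by standard
      (auto simp: Src_Fa Tgt_Fa Fa_in Fo_in C.Src_in C.Tgt_in D.Src_Ident D.Tgt_Ident Ident_in_image
        D.Comp_assoc D.Src_Comp D.Tgt_Comp Comp_in_image unit)
  have "subcategory E D"
    by (intro subcategory.intro subcategory_axioms.intro E D.category_axioms)
      (auto simp: E_def Fo_in Fa_in)
  moreover have "cat_isomorphism C E Fo Fa"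
    by (intro cat_isomorphism.intro cat_isomorphism_axioms.intro cat_functor.intro
        cat_functor_axioms.intro E C.category_axioms)
      (auto simp: E_def Src_Fa Tgt_Fa Fa_Ident Fa_Comp bij_betw_def injo inja)
  ultimately show ?thesis by blast
qed

lemma category_RelCat: "category (RelCat \<U>)"
  by standard (auto simp: RelCat_def)

section \<open>Valuations in the linear order\<close>

context value_order
begin

lemma le_refl: "x \<in> p \<Longrightarrow> (x, x) \<in> le"
  using linear
  by (auto simp: linear_order_on_def partial_order_on_def preorder_on_def refl_on_def)

lemma le_trans: "\<lbrakk>(x, y) \<in> le; (y, z) \<in> le\<rbrakk> \<Longrightarrow> (x, z) \<in> le"
  using linear
  by (auto simp: linear_order_on_def partial_order_on_def preorder_on_def dest: transD)

lemma le_antisym: "\<lbrakk>(x, y) \<in> le; (y, x) \<in> le\<rbrakk> \<Longrightarrow> x = y"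
  using linear
  by (auto simp: linear_order_on_def partial_order_on_def dest: antisymD)

lemma not_one_le_zero: "(one, zero) \<notin> le"
  using le_antisym zero_le_one zero_neq_one by blast

lemma preserves_trancl:
  assumes "\<And>u v. (u, v) \<in> T \<Longrightarrow> (g u, g v) \<in> le" and "(u, v) \<in> T\<^sup>+"
  shows "(g u, g v) \<in> le"
  using assms(2) by induction (auto intro: assms(1) le_trans)

text \<open>
  The extension gives \<open>w\<close> the greatest value found at points of \<open>A\<close> that are \<open>w\<close> or precede
  \<open>w\<close>, or 0 if there are none. Passing from \<open>u\<close> to a later \<open>v\<close> only enlarges the set whose greatest
  element is taken, and on \<open>A\<close> itself that greatest element is the old value.
\<close>

lemma extend_preserving:
  assumes T: "trans T"
    and h: "\<And>w. w \<in> A \<Longrightarrow> h w \<in> p"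
    and pres: "\<And>u v. \<lbrakk>u \<in> A; v \<in> A; (u, v) \<in> T\<rbrakk> \<Longrightarrow> (h u, h v) \<in> le"
  obtains g where "\<And>w. w \<in> A \<Longrightarrow> g w = h w" "\<And>w. g w \<in> p"
    "\<And>u v. (u, v) \<in> T \<Longrightarrow> (g u, g v) \<in> le"
proof -
  define S where "S w = insert zero (h ` {x \<in> A. x = w \<or> (x, w) \<in> T})" for w
  have S_p: "S w \<subseteq> p" for w
    using h zero_in by (auto simp: S_def)
  have "\<exists>m\<in>S w. \<forall>x\<in>S w. (x, m) \<in> le" for w
    using greatest[OF S_p] by (simp add: S_def)
  then obtain g where g_in: "\<And>w. g w \<in> S w" and g_ge: "\<And>w x. x \<in> S w \<Longrightarrow> (x, g w) \<in> le"
    by metis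
  show thesis
  proof (rule that)
    fix w assume w: "w \<in> A"
    have "(x, h w) \<in> le" if "x \<in> S w" for x
      using that w h pres by (auto simp: S_def zero_least le_refl)
    then have "(g w, h w) \<in> le" using g_in by blast
    moreover have "(h w, g w) \<in> le"
      using w by (intro g_ge) (auto simp: S_def)
    ultimately show "g w = h w" by (rule le_antisym)
  next
    show "g w \<in> p" for w using g_in S_p by blast
  next
    fix u v assume "(u, v) \<in> T"
    then have "S u \<subseteq> S v"
      using T by (auto simp: S_def dest: transD)
    then show "(g u, g v) \<in> le" using g_in g_ge by blast
  qed
qed

text \<open>
  The values 0 and 1 differ, so one of them is not the default value that extensional functions
  take outside their domain; a constant function with that value reveals its domain.
\<close>

lemma Fp_obj_inj:
  fixes A :: "'b set set"
  shows "inj_on (Fp_obj p) A"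
proof -
  obtain c where c: "c \<in> p" "c \<noteq> undefined"
    using zero_in one_in zero_neq_one by metis
  have "X \<subseteq> Y" if "Fp_obj p X = Fp_obj p Y" for X Y :: "'b set"
  proof
    fix x assume x: "x \<in> X"
    have "(\<lambda>x\<in>X. c) \<in> Fp_obj p Y"
      unfolding that[symmetric] using c by (auto simp: Fp_obj_def)
    then show "x \<in> Y"
      using x c by (auto simp: Fp_obj_def PiE_def extensional_def)
  qed
  then show ?thesis by (intro inj_onI subset_antisym) simp_all
qed

end

section \<open>Split preorders\<close>

context split_family
begin

lemma cp_eq_image: "X \<in> M \<Longrightarrow> cp i X = emb i X ` X"
  using emb_bij by (metis bij_betw_def)

lemma emb_in: "\<lbrakk>X \<in> M; x \<in> X\<rbrakk> \<Longrightarrow> emb i X x \<in> cp i X"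
  by (simp add: cp_eq_image)

lemma inv_emb: "\<lbrakk>X \<in> M; x \<in> X\<rbrakk> \<Longrightarrow> inv_into X (emb i X) (emb i X x) = x"
  using emb_bij by (metis bij_betw_def inv_into_f_f)

lemma cp_disjoint:
  assumes "X \<in> M" "Y \<in> M"
  shows "u \<in> X \<Longrightarrow> u \<notin> cp i Y" "u \<in> cp Side_s X \<Longrightarrow> u \<notin> cp Side_t Y"
  using disjoint[of X "cp Side_s Y" "cp Side_t Y"] disjoint[of X "cp Side_s X" "cp Side_t Y"] assms
  by (cases i; auto)+

lemma side_unique:
  assumes "X \<in> M" "u \<in> cp i X" "u \<in> cp j X"
  shows "i = j"
  using cp_disjoint(2)[OF assms(1,1), of u] assms(2,3) by (cases i; cases j) auto

lemma split_field_cases: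
  assumes "X \<in> M" "Y \<in> M" "u \<in> split_field cp X Y"
  obtains (s) x where "x \<in> X" "u = emb Side_s X x" | (t) y where "y \<in> Y" "u = emb Side_t Y y"
  using assms by (auto simp: split_field_def cp_eq_image)

lemma copair_s: "\<lbrakk>X \<in> M; x \<in> X\<rbrakk> \<Longrightarrow> copair cp emb X Y f1 f2 (emb Side_s X x) = f1 x"
  by (simp add: copair_def emb_in inv_emb)

lemma copair_t:
  "\<lbrakk>X \<in> M; Y \<in> M; y \<in> Y\<rbrakk> \<Longrightarrow> copair cp emb X Y f1 f2 (emb Side_t Y y) = f2 y"
  using cp_disjoint(2)[of X Y "emb Side_t Y y"] emb_in[of Y y Side_t]
  by (auto simp: copair_def inv_emb)

lemma copair_in:
  assumes "X \<in> M" "Y \<in> M" "f1 \<in> Fp_obj p X" "f2 \<in> Fp_obj p Y" "u \<in> split_field cp X Y"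
  shows "copair cp emb X Y f1 f2 u \<in> p"
  using assms(1,2,5)
  by (cases rule: split_field_cases) (use assms in \<open>auto simp: copair_s copair_t Fp_obj_def\<close>)

lemma phi_s_in:
  "\<lbrakk>X \<in> M; w \<in> X \<union> cp Side_t Y\<rbrakk> \<Longrightarrow> phi_s emb X w \<in> split_field cp X Y"
  by (auto simp: phi_s_def split_field_def emb_in)

lemma phi_t_in:
  "\<lbrakk>Y \<in> M; w \<in> cp Side_s X \<union> Y\<rbrakk> \<Longrightarrow> phi_t emb Y w \<in> split_field cp X Y"
  by (auto simp: phi_t_def split_field_def emb_in)

lemma phi_s_surj:
  assumes "X \<in> M" "Y \<in> M" "u \<in> split_field cp X Y"
  obtains w where "w \<in> X \<union> cp Side_t Y" "phi_s emb X w = u"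
proof (cases "u \<in> cp Side_t Y")
  case True
  then have "phi_s emb X u = u" using cp_disjoint(1)[OF assms(1,2)] by (auto simp: phi_s_def)
  with True that show ?thesis by blast
next
  case False
  then obtain x where "x \<in> X" "u = emb Side_s X x"
    using assms by (auto simp: split_field_def cp_eq_image)
  then show ?thesis using that[of x] by (simp add: phi_s_def)
qed

lemma phi_t_surj:
  assumes "X \<in> M" "Y \<in> M" "u \<in> split_field cp X Y"
  obtains w where "w \<in> cp Side_s X \<union> Y" "phi_t emb Y w = u"
proof (cases "u \<in> cp Side_s X")
  case True
  then have "phi_t emb Y u = u" using cp_disjoint(1)[OF assms(2,1)] by (auto simp: phi_t_def)
  with True that show ?thesis by blast
next
  case False
  then obtain y where "y \<in> Y" "u = emb Side_t Y y"
    using assms by (auto simp: split_field_def cp_eq_image)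
  then show ?thesis using that[of y] by (simp add: phi_t_def)
qed

lemma split_preorder_iff:
  "split_preorder M cp (R, X, Y) \<longleftrightarrow> X \<in> M \<and> Y \<in> M \<and>
     R \<subseteq> split_field cp X Y \<times> split_field cp X Y \<and> (\<forall>u \<in> split_field cp X Y. (u, u) \<in> R) \<and> trans R"
  by (auto simp: split_preorder_def split_relation_def refl_on_def)

lemma split_id_preorder:
  assumes "X \<in> M"
  shows "split_preorder M cp (split_id cp emb X)"
proof -
  let ?I = "{(u, v). \<exists>i j. u \<in> cp i X \<and> v \<in> cp j X \<and>
    inv_into X (emb i X) u = inv_into X (emb j X) v}"
  have "u \<in> split_field cp X X" if "u \<in> cp i X" for u i
    using that by (cases i) (auto simp: split_field_def)
  moreover have "trans ?I"
    by (rule transI) (auto dest: side_unique[OF assms], metis side_unique[OF assms])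
  ultimately show ?thesis
    using assms unfolding split_id_def split_preorder_iff by (auto simp: split_field_def)
qed

text \<open>
  Points of \<open>X\<^sup>s\<close> are related to themselves already in \<open>R\<close>, points of \<open>Z\<^sup>t\<close> already in \<open>P\<close>;
  transitivity is that of the closure.
\<close>

lemma split_comp_preorder:
  assumes R: "split_preorder M cp (R, X, Y)" and P: "split_preorder M cp (P, Y, Z)"
  shows "split_preorder M cp (split_comp cp emb (P, Y, Z) (R, X, Y))"
proof -
  let ?U = "unsplit_t cp emb (R, X, Y) \<union> unsplit_s cp emb (P, Y, Z)"
  have M: "X \<in> M" "Y \<in> M" "Z \<in> M" using R P by (auto simp: split_preorder_iff)
  have "(u, u) \<in> ?U" if "u \<in> split_field cp X Z" for u
    using that R P M phi_t_in[of Y u X] phi_s_in[of Y u Z]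
    by (auto simp: split_field_def[of cp X Z] unsplit_t_def unsplit_s_def split_preorder_iff)
  moreover have "trans (?U\<^sup>+ \<inter> (split_field cp X Z \<times> split_field cp X Z))"
    by (rule trans_Int) (auto simp: trans_def)
  ultimately show ?thesis
    using M by (auto simp: split_comp_def split_preorder_iff)
qed

end

section \<open>Order-preserving valuations of split preorders\<close>

locale split_valuation = split_family M cp emb + value_order p le zero one
  for M :: "'a set set" and cp emb and p :: "'p set" and le zero one
begin

abbreviation F where "F \<equiv> Fp_arr cp emb p le"

lemma F_iff:
  assumes "split_preorder M cp (R, X, Y)"
  shows "(f1, f2) \<in> fst (F (R, X, Y)) \<longleftrightarrow> f1 \<in> Fp_obj p X \<and> f2 \<in> Fp_obj p Y \<and>
    (\<forall>u v. (u, v) \<in> R \<longrightarrow> (copair cp emb X Y f1 f2 u, copair cp emb X Y f1 f2 v) \<in> le)"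
  using assms by (auto simp: Fp_arr_def split_preorder_iff)

text \<open>
  A pair of \<open>P\<close> that is missing from \<open>R\<close> is separated by the characteristic function of a
  principal upper set of \<open>R\<close>, which preserves \<open>R\<close> by transitivity.
\<close>

lemma Fp_arr_subset_imp:
  assumes R: "split_preorder M cp (R, X, Y)" and P: "split_preorder M cp (P, X, Y)"
    and F: "fst (F (R, X, Y)) \<subseteq> fst (F (P, X, Y))"
  shows "P \<subseteq> R"
proof (rule subrelI, rule ccontr)
  fix u v assume uv: "(u, v) \<in> P" "(u, v) \<notin> R"
  have M: "X \<in> M" "Y \<in> M" using R by (auto simp: split_preorder_iff)
  define h where "h w = (if (u, w) \<in> R then one else zero)" for w
  define f1 where "f1 = (\<lambda>x\<in>X. h (emb Side_s X x))"
  define f2 where "f2 = (\<lambda>y\<in>Y. h (emb Side_t Y y))"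
  have f: "f1 \<in> Fp_obj p X" "f2 \<in> Fp_obj p Y"
    by (auto simp: f1_def f2_def Fp_obj_def h_def zero_in one_in)
  have copair: "copair cp emb X Y f1 f2 w = h w" if "w \<in> split_field cp X Y" for w
    using M that
    by (cases rule: split_field_cases) (auto simp: copair_s copair_t M f1_def f2_def)
  have field: "w \<in> split_field cp X Y \<and> w' \<in> split_field cp X Y"
    if "(w, w') \<in> R \<union> P" for w w'
    using that R P by (auto simp: split_preorder_iff)
  have "(h w, h w') \<in> le" if "(w, w') \<in> R" for w w'
    using that R
    by (auto simp: h_def le_refl zero_in one_in zero_le_one split_preorder_iff dest: transD)
  then have "(f1, f2) \<in> fst (F (R, X, Y))"
    using f field by (simp add: F_iff[OF R]) (metis UnI1 copair)
  then have "(h u, h v) \<in> le"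
    using F uv(1) field copair by (fastforce simp: F_iff[OF P])
  moreover have "(u, u) \<in> R"
    using R field uv(1) by (auto simp: split_preorder_iff)
  ultimately show False
    using uv(2) not_one_le_zero by (simp add: h_def)
qed

lemma Fp_arr_inj: "inj_on F {R. split_preorder M cp R}"
proof (rule inj_onI)
  fix f g
  assume fg: "f \<in> {R. split_preorder M cp R}" "g \<in> {R. split_preorder M cp R}" "F f = F g"
  obtain R X Y P X' Y' where f: "f = (R, X, Y)" and g: "g = (P, X', Y')"
    by (metis prod.exhaust)
  have R: "split_preorder M cp (R, X, Y)" and P: "split_preorder M cp (P, X', Y')"
    and eq: "F (R, X, Y) = F (P, X', Y')"
    using fg by (simp_all add: f g)
  then have XY: "X' = X" "Y' = Y"
    by (auto simp: Fp_arr_def dest: inj_onD[OF Fp_obj_inj[of UNIV]])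
  then have "fst (F (R, X, Y)) = fst (F (P, X, Y))" using eq by simp
  then have "R = P"
    using Fp_arr_subset_imp[of R X Y P] Fp_arr_subset_imp[of P X Y R] R P XY by blast
  then show "f = g" using XY f g by simp
qed

lemma Fp_arr_id:
  assumes X: "X \<in> M"
  shows "F (split_id cp emb X) = (Id_on (Fp_obj p X), Fp_obj p X, Fp_obj p X)"
proof -
  obtain I where I: "split_id cp emb X = (I, X, X)" by (simp add: split_id_def)
  have pre: "split_preorder M cp (I, X, X)" using split_id_preorder[OF X] I by simp
  have "f1 = f2" if "(f1, f2) \<in> fst (F (I, X, X))" for f1 f2
  proof (rule PiE_ext)
    note f = that[unfolded F_iff[OF pre]]
    show "f1 \<in> X \<rightarrow>\<^sub>E p" "f2 \<in> X \<rightarrow>\<^sub>E p" using f by (auto simp: Fp_obj_def)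
    fix x assume x: "x \<in> X"
    have "(emb i X x, emb j X x) \<in> I" for i j
    proof -
      have "emb i X x \<in> cp i X \<and> emb j X x \<in> cp j X \<and>
          inv_into X (emb i X) (emb i X x) = inv_into X (emb j X) (emb j X x)"
        by (simp add: emb_in inv_emb X x)
      then show ?thesis using I unfolding split_id_def by blast
    qed
    then have "(copair cp emb X X f1 f2 (emb i X x), copair cp emb X X f1 f2 (emb j X x)) \<in> le"
      for i j
      using f by blast
    from this[of Side_s Side_t] this[of Side_t Side_s]
    have "(f1 x, f2 x) \<in> le" "(f2 x, f1 x) \<in> le"
      by (simp_all add: copair_s copair_t X x)
    then show "f1 x = f2 x" by (rule le_antisym)
  qed
  moreover have "(f, f) \<in> fst (F (I, X, X))" if f: "f \<in> Fp_obj p X" for f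
  proof -
    have copair: "copair cp emb X X f f u = f (inv_into X (emb i X) u)" if "u \<in> cp i X" for u i
      using that X by (cases i) (auto simp: cp_eq_image copair_s copair_t inv_emb)
    have "(copair cp emb X X f f u, copair cp emb X X f f v) \<in> le" if uv: "(u, v) \<in> I" for u v
    proof -
      obtain i j where "u \<in> cp i X" "v \<in> cp j X"
        "inv_into X (emb i X) u = inv_into X (emb j X) v"
        using uv I by (auto simp: split_id_def)
      then have "copair cp emb X X f f u = copair cp emb X X f f v" by (simp add: copair)
      moreover have "copair cp emb X X f f v \<in> p"
        using copair_in[OF X X f f, of v] uv pre by (auto simp: split_preorder_iff)
      ultimately show ?thesis by (simp add: le_refl)
    qed
    then show ?thesis using f by (simp add: F_iff[OF pre])
  qed
  moreover have "f1 \<in> Fp_obj p X" if "(f1, f2) \<in> fst (F (I, X, X))" for f1 f2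
    using that by (simp add: F_iff[OF pre])
  ultimately have "fst (F (I, X, X)) = Id_on (Fp_obj p X)"
    by (simp add: set_eq_iff Id_on_iff) blast
  then show ?thesis by (simp add: I) (simp add: Fp_arr_def)
qed

lemma copair_glue:
  assumes M: "X \<in> M" "Y \<in> M" "Z \<in> M"
    and mid: "\<And>y. y \<in> Y \<Longrightarrow> g y = f2 y"
    and outer: "\<And>w. w \<in> split_field cp X Z \<Longrightarrow> g w = copair cp emb X Z f1 f3 w"
  shows "w \<in> cp Side_s X \<union> Y \<Longrightarrow> copair cp emb X Y f1 f2 (phi_t emb Y w) = g w"
    and "w \<in> Y \<union> cp Side_t Z \<Longrightarrow> copair cp emb Y Z f2 f3 (phi_s emb Y w) = g w"
proof -
  show "copair cp emb X Y f1 f2 (phi_t emb Y w) = g w" if w: "w \<in> cp Side_s X \<union> Y"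
  proof (cases "w \<in> Y")
    case True
    then show ?thesis by (simp add: phi_t_def copair_t M mid)
  next
    case False
    then obtain x where "x \<in> X" "w = emb Side_s X x" using w M by (auto simp: cp_eq_image)
    then show ?thesis
      using False outer[of w] M by (simp add: phi_t_def copair_s emb_in split_field_def)
  qed
  show "copair cp emb Y Z f2 f3 (phi_s emb Y w) = g w" if w: "w \<in> Y \<union> cp Side_t Z"
  proof (cases "w \<in> Y")
    case True
    then show ?thesis by (simp add: phi_s_def copair_s M mid)
  next
    case False
    then obtain z where "z \<in> Z" "w = emb Side_t Z z" using w M by (auto simp: cp_eq_image)
    then show ?thesis
      using False outer[of w] M by (simp add: phi_s_def copair_t emb_in split_field_def)
  qed
qed

text \<open>
  Un-splitting a relation transports its points along the maps \<open>\<phi>\<close>, so it does not change which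
  valuations are order-preserving.
\<close>

lemma preserves_unsplit:
  assumes R: "split_preorder M cp (R, X, Y)" and P: "split_preorder M cp (P, Y, Z)"
    and mid: "\<And>y. y \<in> Y \<Longrightarrow> g y = f2 y"
    and outer: "\<And>w. w \<in> split_field cp X Z \<Longrightarrow> g w = copair cp emb X Z f1 f3 w"
  shows "(\<forall>u v. (u, v) \<in> unsplit_t cp emb (R, X, Y) \<longrightarrow> (g u, g v) \<in> le) \<longleftrightarrow>
      (\<forall>u v. (u, v) \<in> R \<longrightarrow> (copair cp emb X Y f1 f2 u, copair cp emb X Y f1 f2 v) \<in> le)"
    and "(\<forall>u v. (u, v) \<in> unsplit_s cp emb (P, Y, Z) \<longrightarrow> (g u, g v) \<in> le) \<longleftrightarrow>
      (\<forall>u v. (u, v) \<in> P \<longrightarrow> (copair cp emb Y Z f2 f3 u, copair cp emb Y Z f2 f3 v) \<in> le)"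
proof -
  have M: "X \<in> M" "Y \<in> M" "Z \<in> M" using R P by (auto simp: split_preorder_iff)
  note glue = copair_glue[where g = g, OF M mid outer]
  show "(\<forall>u v. (u, v) \<in> unsplit_t cp emb (R, X, Y) \<longrightarrow> (g u, g v) \<in> le) \<longleftrightarrow>
      (\<forall>u v. (u, v) \<in> R \<longrightarrow> (copair cp emb X Y f1 f2 u, copair cp emb X Y f1 f2 v) \<in> le)"
    (is "?unsplit \<longleftrightarrow> ?split")
  proof
    assume L: ?unsplit
    show ?split
    proof (intro allI impI)
      fix u v assume uv: "(u, v) \<in> R"
      then have "u \<in> split_field cp X Y" "v \<in> split_field cp X Y"
        using R by (auto simp: split_preorder_iff)
      then obtain a b where ab: "a \<in> cp Side_s X \<union> Y" "phi_t emb Y a = u"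
        "b \<in> cp Side_s X \<union> Y" "phi_t emb Y b = v"
        using M by (metis phi_t_surj)
      then have "(a, b) \<in> unsplit_t cp emb (R, X, Y)" using uv by (simp add: unsplit_t_def)
      then show "(copair cp emb X Y f1 f2 u, copair cp emb X Y f1 f2 v) \<in> le"
        using L ab glue(1) by metis
    qed
  next
    assume ?split
    then show ?unsplit by (auto simp: unsplit_t_def glue(1)[symmetric] simp del: Un_iff)
  qed
  show "(\<forall>u v. (u, v) \<in> unsplit_s cp emb (P, Y, Z) \<longrightarrow> (g u, g v) \<in> le) \<longleftrightarrow>
      (\<forall>u v. (u, v) \<in> P \<longrightarrow> (copair cp emb Y Z f2 f3 u, copair cp emb Y Z f2 f3 v) \<in> le)"
    (is "?unsplit \<longleftrightarrow> ?split")
  proof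
    assume L: ?unsplit
    show ?split
    proof (intro allI impI)
      fix u v assume uv: "(u, v) \<in> P"
      then have "u \<in> split_field cp Y Z" "v \<in> split_field cp Y Z"
        using P by (auto simp: split_preorder_iff)
      then obtain a b where ab: "a \<in> Y \<union> cp Side_t Z" "phi_s emb Y a = u"
        "b \<in> Y \<union> cp Side_t Z" "phi_s emb Y b = v"
        using M by (metis phi_s_surj)
      then have "(a, b) \<in> unsplit_s cp emb (P, Y, Z)" using uv by (simp add: unsplit_s_def)
      then show "(copair cp emb Y Z f2 f3 u, copair cp emb Y Z f2 f3 v) \<in> le"
        using L ab glue(2) by metis
    qed
  next
    assume ?split
    then show ?unsplit by (auto simp: unsplit_s_def glue(2)[symmetric] simp del: Un_iff)
  qed
qed

lemma Fp_arr_comp: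
  assumes R: "split_preorder M cp (R, X, Y)" and P: "split_preorder M cp (P, Y, Z)"
  shows "F (split_comp cp emb (P, Y, Z) (R, X, Y)) =
    (fst (F (R, X, Y)) O fst (F (P, Y, Z)), Fp_obj p X, Fp_obj p Z)"
proof -
  have M: "X \<in> M" "Y \<in> M" "Z \<in> M" using R P by (auto simp: split_preorder_iff)
  let ?A = "split_field cp X Z"
  let ?U = "unsplit_t cp emb (R, X, Y) \<union> unsplit_s cp emb (P, Y, Z)"
  define Q where "Q = ?U\<^sup>+ \<inter> (?A \<times> ?A)"
  have comp: "split_comp cp emb (P, Y, Z) (R, X, Y) = (Q, X, Z)"
    by (simp add: split_comp_def Q_def)
  have Q: "split_preorder M cp (Q, X, Z)"
    using split_comp_preorder[OF R P] comp by simp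
  have Y_outer: "w \<notin> Y" if "w \<in> ?A" for w
    using that M cp_disjoint(1)[of Y] by (auto simp: split_field_def)
  have "(f1, f3) \<in> fst (F (Q, X, Z))"
    if f12: "(f1, f2) \<in> fst (F (R, X, Y))" and f23: "(f2, f3) \<in> fst (F (P, Y, Z))" for f1 f2 f3
  proof -
    define g where "g w = (if w \<in> Y then f2 w else copair cp emb X Z f1 f3 w)" for w
    have mid: "g y = f2 y" if "y \<in> Y" for y using that by (simp add: g_def)
    have outer: "g w = copair cp emb X Z f1 f3 w" if "w \<in> ?A" for w
      using Y_outer[OF that] by (simp add: g_def)
    note iff = preserves_unsplit[where g = g, OF R P mid outer]
    have "(g u, g v) \<in> le" if "(u, v) \<in> ?U" for u v
      using that f12 f23 iff by (auto simp: F_iff[OF R] F_iff[OF P])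
    then have "(g u, g v) \<in> le" if "(u, v) \<in> ?U\<^sup>+" for u v
      using that by (rule preserves_trancl)
    then have "(copair cp emb X Z f1 f3 u, copair cp emb X Z f1 f3 v) \<in> le"
      if "(u, v) \<in> Q" for u v
      using that outer by (metis IntD1 IntD2 Q_def mem_Sigma_iff)
    then show ?thesis
      using f12 f23 by (simp add: F_iff[OF R] F_iff[OF P] F_iff[OF Q])
  qed
  moreover have "\<exists>f2. (f1, f2) \<in> fst (F (R, X, Y)) \<and> (f2, f3) \<in> fst (F (P, Y, Z))"
    if f13: "(f1, f3) \<in> fst (F (Q, X, Z))" for f1 f3
  proof -
    note f = f13[unfolded F_iff[OF Q]]
    obtain g where outer: "\<And>w. w \<in> ?A \<Longrightarrow> g w = copair cp emb X Z f1 f3 w"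
      and g_in: "\<And>w. g w \<in> p"
      and g_pres: "\<And>u v. (u, v) \<in> ?U\<^sup>+ \<Longrightarrow> (g u, g v) \<in> le"
    proof (rule extend_preserving[of "?U\<^sup>+" ?A "copair cp emb X Z f1 f3"])
      show "trans (?U\<^sup>+)" by (rule trans_trancl)
      show "copair cp emb X Z f1 f3 w \<in> p" if "w \<in> ?A" for w
        using copair_in[OF M(1,3) _ _ that] f by blast
    qed (use f in \<open>auto simp: Q_def\<close>)
    define f2 where "f2 = restrict g Y"
    have mid: "g y = f2 y" if "y \<in> Y" for y using that by (simp add: f2_def)
    have "f2 \<in> Fp_obj p Y" using g_in by (auto simp: f2_def Fp_obj_def)
    moreover note preserves_unsplit[where g = g, OF R P mid outer]
    ultimately show ?thesis
      using f g_pres by (intro exI[of _ f2]) (auto simp: F_iff[OF R] F_iff[OF P])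
  qed
  ultimately have "fst (F (Q, X, Z)) = fst (F (R, X, Y)) O fst (F (P, Y, Z))"
    by (auto simp: set_eq_iff relcomp_unfold)
  then show ?thesis by (simp add: comp) (simp add: Fp_arr_def)
qed

end

section \<open>The embedding of split preorders into relations\<close>

theorem mainTheorem1:
  fixes M :: "'a set set"
    and cp :: "side \<Rightarrow> 'a set \<Rightarrow> 'a set"
    and emb :: "side \<Rightarrow> 'a set \<Rightarrow> 'a \<Rightarrow> 'a"
    and p :: "'p set" and le :: "'p rel" and zero one :: 'p
    and \<U> :: "('a \<Rightarrow> 'p) set set"
  assumes "split_family M cp emb"
    and "value_order p le zero one"
    and "\<And>X. X \<in> M \<Longrightarrow> Fp_obj p X \<in> \<U>"
  shows "category (SplPre M cp emb)
    \<and> faithful_functor (SplPre M cp emb) (RelCat \<U>) (Fp_obj p) (Fp_arr cp emb p le)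
    \<and> inj_on (Fp_obj p) (Obj (SplPre M cp emb))
    \<and> inj_on (Fp_arr cp emb p le) (Arr (SplPre M cp emb))
    \<and> (\<exists>D. subcategory D (RelCat \<U>)
         \<and> cat_isomorphism (SplPre M cp emb) D (Fp_obj p) (Fp_arr cp emb p le))"
proof -
  let ?C = "SplPre M cp emb" and ?D = "RelCat \<U>" and ?Fa = "Fp_arr cp emb p le"
  interpret split_valuation M cp emb p le zero one
    using assms(1,2) by (rule split_valuation.intro)
  have obj: "Src ?C f \<in> Obj ?C" "Tgt ?C f \<in> Obj ?C" if "f \<in> Arr ?C" for f
    using that by (cases f; auto simp: SplPre_def split_preorder_iff)+
  have ident: "Ident ?C a \<in> Arr ?C \<and> Src ?C (Ident ?C a) = a \<and> Tgt ?C (Ident ?C a) = a"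
    if "a \<in> Obj ?C" for a
    using that split_id_preorder by (simp add: SplPre_def) (simp add: split_id_def)
  have cmp: "Comp ?C g f \<in> Arr ?C \<and> Src ?C (Comp ?C g f) = Src ?C f \<and> Tgt ?C (Comp ?C g f) = Tgt ?C g"
    if fg: "f \<in> Arr ?C" "g \<in> Arr ?C" "Src ?C g = Tgt ?C f" for f g
  proof -
    obtain R X Y P Z where "f = (R, X, Y)" "g = (P, Y, Z)"
      "split_preorder M cp (R, X, Y)" "split_preorder M cp (P, Y, Z)"
      using fg by (cases f; cases g) (auto simp: SplPre_def)
    then show ?thesis
      using split_comp_preorder[of R X Y P Z] by (simp add: SplPre_def) (simp add: split_comp_def)
  qed
  have Fa: "?Fa f \<in> Arr ?D \<and> Src ?D (?Fa f) = Fp_obj p (Src ?C f) \<and> Tgt ?D (?Fa f) = Fp_obj p (Tgt ?C f)"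
    if "f \<in> Arr ?C" for f
    using that by (cases f) (auto simp: SplPre_def RelCat_def Fp_arr_def split_preorder_iff assms(3))
  have FId: "?Fa (Ident ?C a) = Ident ?D (Fp_obj p a)" if "a \<in> Obj ?C" for a
    using that Fp_arr_id by (simp add: SplPre_def RelCat_def)
  have FCmp: "?Fa (Comp ?C g f) = Comp ?D (?Fa g) (?Fa f)"
    if fg: "f \<in> Arr ?C" "g \<in> Arr ?C" "Src ?C g = Tgt ?C f" for f g
  proof -
    obtain R X Y P Z where "f = (R, X, Y)" "g = (P, Y, Z)"
      "split_preorder M cp (R, X, Y)" "split_preorder M cp (P, Y, Z)"
      using fg by (cases f; cases g) (auto simp: SplPre_def)
    then show ?thesis
      using Fp_arr_comp[of R X Y P Z] by (simp add: SplPre_def RelCat_def) (simp add: Fp_arr_def)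
  qed
  have injo: "inj_on (Fp_obj p) (Obj ?C)" by (rule Fp_obj_inj)
  have inja: "inj_on ?Fa (Arr ?C)" using Fp_arr_inj by (simp add: SplPre_def)
  have C: "category ?C"
    by (rule category_reflect[OF category_RelCat[of \<U>] obj ident cmp Fa FId FCmp inja])
  interpret FF: cat_functor ?C ?D "Fp_obj p" ?Fa
    by (intro cat_functor.intro cat_functor_axioms.intro C category_RelCat)
      (use Fa FId FCmp assms(3) in \<open>auto simp: SplPre_def RelCat_def\<close>)
  have "faithful_functor ?C ?D (Fp_obj p) ?Fa"
    by standard (rule inj_onD[OF inja])
  then show ?thesis
    using C injo inja FF.image_subcategory[OF injo inja] by blast
qed

end
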